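(* Let $\vec v=(v_1,0,v_3)$ be a unit vector of $\mathbb R^3$ with $v_3>0$, let $\lambda\geq 0$, and let $(y,z,\theta):\mathbb R\to\mathbb R^3$ be a solution of $$y'(s)=\cos\theta(s),\qquad z'(s)=\sin\theta(s),\qquad \theta'(s)=2\lambda+v_3\cos\theta(s),$$ with $y(0)=z(0)=0$ and $\theta(0)=\theta_0\in\mathbb R$, such that the planar curve $\alpha(s)=(y(s),z(s))$ is not a straight line. Then: \begin{enumerate} \item If $\lambda>v_3/2$, the trace of $\alpha$ is invariant under a (nontrivial) discrete group of horizontal translations of the $yz$-plane, and the angle function $\theta$ rotates infinitely many times around the origin. \item If $\lambda=v_3/2$, the trace of $\alpha$ has one self-intersection point and it is symmetric about a vertical line. \item If $0<\lambda<v_3/2$, the trace of $\alpha$ has two branches asymptotic to two lines of slopes $\pm\tan\theta_1$, where $2\lambda+v_3\cos\theta_1=0$. Depending on the initial value $\theta_0$, one of the following holds: \begin{enumerate} \item $\alpha$ is symmetric about a vertical line and has one point of self-intersection; \item $\alpha$ is a convex graph on the (whole) real $y$-line. \end{enumerate} \item If $\lambda=0$, then $\alpha$ is the grim reaper. \end{enumerate}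
   Context: A $\lambda$-translating soliton with density vector $\vec v$ ($|\vec v|=1$) is an orientable surface in $\mathbb R^3$ whose mean curvature $H$ satisfies $2H=2\lambda+\langle N,\vec v\rangle$, with $N$ the Gauss map. A cylindrical surface with rulings parallel to $\vec a=(1,0,0)$ is parametrized by $X(s,t)=(t,y(s),z(s))$, $t\in\mathbb R$, with $\alpha(s)=(y(s),z(s))$ parametrized by arc length. With $y'=\cos\theta$, $z'=\sin\theta$, such a surface is a $\lambda$-translating soliton with density vector $\vec v=(v_1,0,v_3)$ exactly when the system in the claim holds. The result thus classifies the non-planar cylindrical $\lambda$-translating solitons whose rulings are not parallel to the density vector. All solutions of the system are defined on $\mathbb R$. "Horizontal" means parallel to the $y$-axis, "vertical" means parallel to the $z$-axis. The statement that $\theta$ rotates infinitely many times around the origin means that $\theta(s)\to\pm\infty$ as $s\to\pm\infty$. The grim reaper is, up to translation, the curve $z=-\frac{1}{v_3}\log|\cos(v_3y)|$, $|y|<\pi/(2v_3)$ (for $v_3=1$: $z=-\log|\cos y|$). *)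

theory Defs
  imports "HOL-Analysis.Analysis"
begin

text \<open>
  The \<open>yz\<close>-plane is \<^typ>\<open>real \<times> real\<close> with its Euclidean norm: first component
  \<open>y\<close> (horizontal), second component \<open>z\<close> (vertical).  The trace of a curve
  \<open>\<alpha>\<close> is \<open>range \<alpha>\<close>.
\<close>

text \<open>A group of translations is identified with the additive group of its translation vectors.\<close>

definition additive_subgroup :: "'a::ab_group_add set \<Rightarrow> bool" where
  "additive_subgroup G \<longleftrightarrow> 0 \<in> G \<and> (\<forall>a\<in>G. \<forall>b\<in>G. a + b \<in> G) \<and> (\<forall>a\<in>G. - a \<in> G)"

definition invariant_under_discrete_horizontal_translations :: "(real \<times> real) set \<Rightarrow> bool" where
  "invariant_under_discrete_horizontal_translations S \<longleftrightarrow>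
     (\<exists>G. additive_subgroup G \<and> discrete G \<and> G \<noteq> {0} \<and> (\<forall>g\<in>G. snd g = 0) \<and>
          (\<forall>g\<in>G. (\<lambda>p. p + g) ` S = S))"

definition self_intersection_points :: "(real \<Rightarrow> 'a) \<Rightarrow> 'a set" where
  "self_intersection_points \<gamma> = {p. \<exists>s t. s \<noteq> t \<and> \<gamma> s = p \<and> \<gamma> t = p}"

text \<open>The map below is the reflection in the vertical line \<open>y = c\<close>.\<close>

definition symmetric_about_vertical_line :: "(real \<times> real) set \<Rightarrow> bool" where
  "symmetric_about_vertical_line S \<longleftrightarrow> (\<exists>c. (\<lambda>(y, z). (2 * c - y, z)) ` S = S)"

definition line_with_slope :: "real \<Rightarrow> real \<Rightarrow> (real \<times> real) set" where
  "line_with_slope m c = {(y, z). z = m * y + c}"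

text \<open>
  The branch of the curve is selected by the filter: \<open>at_top\<close> for the end
  \<open>s \<rightarrow> \<infinity>\<close>, \<open>at_bot\<close> for the end \<open>s \<rightarrow> -\<infinity>\<close>.  The branch has to leave every
  bounded set, so mere convergence to a point of the line does not count.
\<close>

definition branch_asymptotic_to :: "(real \<Rightarrow> real \<times> real) \<Rightarrow> real filter \<Rightarrow> (real \<times> real) set \<Rightarrow> bool" where
  "branch_asymptotic_to \<gamma> F L \<longleftrightarrow>
     filterlim \<gamma> at_infinity F \<and> ((\<lambda>s. infdist (\<gamma> s) L) \<longlongrightarrow> 0) F"

definition convex_entire_graph :: "(real \<times> real) set \<Rightarrow> bool" where
  "convex_entire_graph S \<longleftrightarrow> (\<exists>f. convex_on UNIV f \<and> S = {(y, z). z = f y})"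

definition grim_reaper :: "real \<Rightarrow> (real \<times> real) set" where
  "grim_reaper w = {(y, z). \<bar>y\<bar> < pi / (2 * w) \<and> z = - (1 / w) * ln \<bar>cos (w * y)\<bar>}"

end

theory Submission
  imports Defs
begin

text \<open>
  Write \<open>a = 2\<lambda>\<close>, \<open>v = v\<^sub>3\<close> and \<open>\<kappa> = \<theta>' = a + v cos \<theta>\<close> for the curvature of the profile curve.
  Two first integrals replace the explicit integration of the system. Since \<open>\<theta>' = a + v y'\<close>, the
  quantity \<open>\<theta> - a s - v y\<close> is constant; since \<open>\<kappa>' = - v z' \<kappa>\<close>, so is \<open>\<kappa> exp (v z)\<close>. The second
  one shows that \<open>\<kappa>\<close> vanishes everywhere, in which case the curve is a straight line, or has a
  constant sign. It also recovers \<open>z\<close> from \<open>\<theta>\<close>, while the first one recovers \<open>y\<close> from \<open>\<theta>\<close> and \<open>s\<close>.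
  The geometry is therefore governed by the scalar equation for \<open>\<theta>\<close>.

  If \<open>a > v\<close>, then \<open>\<kappa>\<close> is bounded below by \<open>a - v > 0\<close>, so \<open>\<theta>\<close> runs monotonically through all of \<open>\<real>\<close>.
  By uniqueness of solutions, after a full turn the curve repeats itself up to a horizontal
  translation. That translation is nontrivial because \<open>a y - sin \<theta>\<close> has derivative
  \<open>- v (cos \<theta>)\<^sup>2\<close> (\<open>full_turn_moves_left\<close>).

  If \<open>\<bar>a\<bar> \<le> v\<close>, reversing the orientation turns \<open>(a, \<kappa>)\<close> into \<open>(-a, -\<kappa>)\<close>. Allowing \<open>a\<close> to be negative,
  one may thus assume \<open>\<kappa> > 0\<close>, and after adding a multiple of \<open>2\<pi>\<close> the angle increases from \<open>-\<tau>\<close>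
  to \<open>\<tau>\<close>, where \<open>\<tau> = arccos (-a/v)\<close> (\<open>trapped_profile\<close>, \<open>range_angle\<close>). The remaining cases differ
  only in the position of \<open>\<tau>\<close> relative to \<open>\<pi>/2\<close>:

  \<^item> For \<open>a > 0\<close> the angle \<open>\<tau>\<close> is obtuse. The curve is symmetric about the vertical line through its
    lowest point, and its right half first moves to the right and then back to the left beyond that
    line. It crosses the line exactly once, and this crossing is the only self-intersection. This
    covers \<open>\<lambda> = v\<^sub>3/2\<close>, where \<open>\<tau> = \<pi>\<close>, and the case \<open>\<kappa> > 0\<close> of \<open>0 < \<lambda> < v\<^sub>3/2\<close>.

  \<^item> For \<open>a < 0\<close> the angle \<open>\<tau>\<close> is acute, so \<open>y' \<ge> cos \<tau> > 0\<close> and the slope \<open>tan \<theta>\<close> increases along the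
    curve: a convex entire graph. After reversal this is the case \<open>\<kappa> < 0\<close> of \<open>0 < \<lambda> < v\<^sub>3/2\<close>.

  \<^item> For \<open>a = 0\<close> the first integrals read \<open>v y = \<theta> + const\<close> and \<open>v z = - log (cos \<theta>) + const\<close>, which is
    the grim reaper parametrized by its angle \<open>\<theta> \<in> (-\<pi>/2, \<pi>/2)\<close>.

  For \<open>\<bar>a\<bar> < v\<close> the difference between the curve and the uniform motion
  \<open>s (cos \<tau>, sin \<tau>)\<close> converges as \<open>s \<rightarrow> \<infinity>\<close> (\<open>asymptotic_direction\<close>), which gives the asymptotic lines.
\<close>

section \<open>Scalar differential equations and asymptotic lines\<close>

lemma continuous_on_if_differentiable:
  fixes f :: "real \<Rightarrow> real"
  assumes "\<And>s. (f has_real_derivative f' s) (at s)"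
  shows "continuous_on S f"
  using assms by (intro continuous_at_imp_continuous_on ballI DERIV_isCont)

lemma derivative_bounded_below_diverges:
  fixes f :: "real \<Rightarrow> real"
  assumes der: "\<And>s. (f has_real_derivative f' s) (at s)"
    and bound: "\<And>s. f' s \<ge> c" and "c > 0"
  shows "filterlim f at_top at_top" and "filterlim f at_bot at_bot" and "surj f"
proof -
  have growth: "f t - f s \<ge> c * (t - s)" if "s \<le> t" for s t
  proof -
    have "f s - c * s \<le> f t - c * t"
    proof (rule DERIV_nonneg_imp_nondecreasing[OF that])
      fix x
      have "((\<lambda>s. f s - c * s) has_real_derivative f' x - c) (at x)"
        by (auto intro!: derivative_eq_intros der)
      then show "\<exists>y. ((\<lambda>s. f s - c * s) has_real_derivative y) (at x) \<and> 0 \<le> y"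
        using bound[of x] by auto
    qed
    then show ?thesis by (simp add: algebra_simps)
  qed
  show top: "filterlim f at_top at_top"
    unfolding filterlim_at_top eventually_at_top_linorder
  proof
    fix Z
    show "\<exists>N. \<forall>n\<ge>N. Z \<le> f n"
    proof (intro exI allI impI)
      fix n assume n: "n \<ge> max 0 ((Z - f 0) / c)"
      then have "Z - f 0 \<le> c * n" using \<open>c > 0\<close> by (simp add: field_simps)
      then show "Z \<le> f n" using growth[of 0 n] n by simp
    qed
  qed
  show bot: "filterlim f at_bot at_bot"
    unfolding filterlim_at_bot eventually_at_bot_linorder
  proof
    fix Z
    show "\<exists>N. \<forall>n\<le>N. f n \<le> Z"
    proof (intro exI allI impI)
      fix n assume n: "n \<le> min 0 ((Z - f 0) / c)"
      then have "c * n \<le> Z - f 0" using \<open>c > 0\<close> by (simp add: field_simps)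
      then show "f n \<le> Z" using growth[of n 0] n by simp
    qed
  qed
  show "surj f"
  unfolding surj_def
  proof
    fix p
    obtain t where t: "f t \<ge> p" "t \<ge> 0"
      using top unfolding filterlim_at_top eventually_at_top_linorder by (metis linorder_linear)
    obtain s where s: "f s \<le> p" "s \<le> 0"
      using bot unfolding filterlim_at_bot eventually_at_bot_linorder by (metis linorder_linear)
    have "continuous_on {s..t} f"
      by (rule continuous_on_if_differentiable[OF der])
    then show "\<exists>x. p = f x"
      using IVT'[of f s p t] s t by force
  qed
qed

text \<open>
  A Gronwall argument: the Lipschitz bound makes \<open>(x - w)\<^sup>2\<close> grow at most like \<open>exp (2 L \<bar>s - t\<bar>)\<close>
  times its value at \<open>t\<close>, which is \<open>0\<close>.
\<close>

lemma autonomous_ode_unique: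
  fixes f x w :: "real \<Rightarrow> real"
  assumes lip: "\<And>p q. \<bar>f p - f q\<bar> \<le> L * \<bar>p - q\<bar>"
    and x: "\<And>s. (x has_real_derivative f (x s)) (at s)"
    and w: "\<And>s. (w has_real_derivative f (w s)) (at s)"
    and "x t = w t"
  shows "x s = w s"
proof -
  define E where "E c s = (x s - w s)\<^sup>2 * exp (c * s)" for c s
  have E: "(E c has_real_derivative
      (2 * ((x s - w s) * (f (x s) - f (w s))) + c * (x s - w s)\<^sup>2) * exp (c * s)) (at s)" for c s
    unfolding E_def
    by (auto intro!: derivative_eq_intros x w simp: algebra_simps power2_eq_square)
  have bound: "\<bar>(x s - w s) * (f (x s) - f (w s))\<bar> \<le> L * (x s - w s)\<^sup>2" for s
  proof -
    have "\<bar>x s - w s\<bar> * \<bar>f (x s) - f (w s)\<bar> \<le> \<bar>x s - w s\<bar> * (L * \<bar>x s - w s\<bar>)"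
      by (intro mult_left_mono lip) auto
    also have "\<dots> = L * \<bar>x s - w s\<bar>\<^sup>2" by (simp add: power2_eq_square algebra_simps)
    finally show ?thesis by (simp add: abs_mult)
  qed
  have "(x s - w s)\<^sup>2 = 0"
  proof (cases "t \<le> s")
    case True
    have "E (- (2 * L)) s \<le> E (- (2 * L)) t"
    proof (rule DERIV_nonpos_imp_nonincreasing[OF True])
      fix r
      have "(2 * ((x r - w r) * (f (x r) - f (w r))) + - (2 * L) * (x r - w r)\<^sup>2)
          * exp (- (2 * L) * r) \<le> 0"
        using bound[of r] by (intro mult_nonpos_nonneg) auto
      with E show "\<exists>y. (E (- (2 * L)) has_real_derivative y) (at r) \<and> y \<le> 0" by blast
    qed
    then show ?thesis using \<open>x t = w t\<close> by (simp add: E_def mult_le_0_iff)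
  next
    case False
    then have "s \<le> t" by simp
    have "E (2 * L) s \<le> E (2 * L) t"
    proof (rule DERIV_nonneg_imp_nondecreasing[OF \<open>s \<le> t\<close>])
      fix r
      have "0 \<le> (2 * ((x r - w r) * (f (x r) - f (w r))) + (2 * L) * (x r - w r)\<^sup>2)
          * exp ((2 * L) * r)"
        using bound[of r] by (intro mult_nonneg_nonneg) auto
      with E show "\<exists>y. (E (2 * L) has_real_derivative y) (at r) \<and> 0 \<le> y" by blast
    qed
    then show ?thesis using \<open>x t = w t\<close> by (simp add: E_def mult_le_0_iff)
  qed
  then show ?thesis by simp
qed

text \<open>
  If the solution stayed below some \<open>p < q\<close>, its speed would be bounded below by the positive minimum
  of \<open>f\<close> on the compact interval \<open>[x 0, p]\<close>, and it would exceed \<open>p\<close> in finite time.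
\<close>

lemma autonomous_ode_tendsto_barrier:
  fixes f x :: "real \<Rightarrow> real"
  assumes x: "\<And>s. (x has_real_derivative f (x s)) (at s)"
    and increasing: "\<And>s. f (x s) > 0"
    and below: "\<And>s. x s < q"
    and cont: "continuous_on {x 0..<q} f"
    and pos: "\<And>p. x 0 \<le> p \<Longrightarrow> p < q \<Longrightarrow> f p > 0"
  shows "(x \<longlongrightarrow> q) at_top"
proof -
  have mono: "x s \<le> x t" if "s \<le> t" for s t
    using x increasing by (intro DERIV_nonneg_imp_nondecreasing[OF that]) (meson less_imp_le)
  have reach: "\<exists>s. p < x s" if "p < q" for p
  proof (rule ccontr)
    assume "\<not> (\<exists>s. p < x s)"
    then have le: "x s \<le> p" for s by (meson not_le)
    have "continuous_on {x 0..p} f"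
      by (rule continuous_on_subset[OF cont]) (use that in auto)
    then obtain m where m: "m \<in> {x 0..p}" "\<And>u. u \<in> {x 0..p} \<Longrightarrow> f m \<le> f u"
      using continuous_attains_inf[of "{x 0..p}" f] le[of 0] by auto
    have fm: "f m > 0" using pos[of m] m(1) that by auto
    define t where "t = (p - x 0) / f m + 1"
    have t: "t \<ge> 0" using fm le[of 0] by (simp add: t_def)
    have "x 0 - f m * 0 \<le> x t - f m * t"
    proof (rule DERIV_nonneg_imp_nondecreasing[OF t])
      fix s assume s: "0 \<le> s" "s \<le> t"
      have "((\<lambda>s. x s - f m * s) has_real_derivative f (x s) - f m) (at s)"
        by (auto intro!: derivative_eq_intros x)
      moreover have "f m \<le> f (x s)" using m(2) le[of s] mono[OF s(1)] by auto
      ultimately show "\<exists>y. ((\<lambda>s. x s - f m * s) has_real_derivative y) (at s) \<and> 0 \<le> y"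
        by (metis diff_ge_0_iff_ge)
    qed
    moreover have "f m * t = p - x 0 + f m" using fm by (simp add: t_def field_simps)
    ultimately show False using le[of t] fm by simp
  qed
  show ?thesis
  proof (rule order_tendstoI)
    fix p assume "p < q"
    then obtain s where "p < x s" using reach by blast
    then show "\<forall>\<^sub>F s in at_top. p < x s"
      unfolding eventually_at_top_linorder using mono by (meson less_le_trans)
  next
    fix p assume "q < p"
    then show "\<forall>\<^sub>F s in at_top. x s < p"
      using below by (intro always_eventually) (meson less_trans)
  qed
qed

text \<open>
  The filter \<open>F\<close> stands for either end of the real line. Eliminating \<open>s\<close> from the limiting motion
  \<open>(p + s c, q + s w)\<close> gives the equation of the line.
\<close>

lemma branch_asymptotic_toI:
  fixes f g :: "real \<Rightarrow> real"
  assumes f: "((\<lambda>s. f s - s * c) \<longlongrightarrow> p) F" and g: "((\<lambda>s. g s - s * w) \<longlongrightarrow> q) F"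
    and "c \<noteq> 0" and F: "filterlim (\<lambda>s. s) at_infinity F"
  shows "branch_asymptotic_to (\<lambda>s. (f s, g s)) F (line_with_slope (w / c) (q - w / c * p))"
  unfolding branch_asymptotic_to_def
proof
  have "filterlim (\<lambda>s. s * c) at_infinity F"
    using tendsto_mult_filterlim_at_infinity[OF tendsto_const \<open>c \<noteq> 0\<close> F] by (simp add: mult.commute)
  then have "filterlim (\<lambda>s. (f s - s * c) + s * c) at_infinity F"
    by (rule tendsto_add_filterlim_at_infinity[OF f])
  then have "filterlim (\<lambda>s. norm (f s)) at_top F"
    by (simp add: filterlim_at_infinity_conv_norm_at_top)
  then have "filterlim (\<lambda>s. norm (f s, g s)) at_top F"
    by (rule filterlim_at_top_mono) (simp add: norm_Pair real_sqrt_sum_squares_ge1 del: real_norm_def)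
  then show "filterlim (\<lambda>s. (f s, g s)) at_infinity F"
    by (simp add: filterlim_at_infinity_conv_norm_at_top)
next
  let ?L = "line_with_slope (w / c) (q - w / c * p)"
  let ?h = "\<lambda>s. (g s - s * w) - w / c * (f s - s * c) - (q - w / c * p)"
  have "(?h \<longlongrightarrow> q - w / c * p - (q - w / c * p)) F"
    by (intro tendsto_intros f g)
  then have "((\<lambda>s. \<bar>?h s\<bar>) \<longlongrightarrow> 0) F" by (simp add: tendsto_rabs_zero)
  moreover have "infdist (f s, g s) ?L \<le> \<bar>?h s\<bar>" for s
  proof (rule infdist_le2)
    show "(f s, w / c * f s + (q - w / c * p)) \<in> ?L" by (simp add: line_with_slope_def)
    have "?h s = g s - (w / c * f s + (q - w / c * p))"
      using \<open>c \<noteq> 0\<close> by (simp add: right_diff_distrib)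
    then show "dist (f s, g s) (f s, w / c * f s + (q - w / c * p)) \<le> \<bar>?h s\<bar>"
      by (simp add: dist_Pair_Pair dist_real_def)
  qed
  ultimately show "((\<lambda>s. infdist (f s, g s) ?L) \<longlongrightarrow> 0) F"
    using tendsto_sandwich[OF always_eventually always_eventually tendsto_const, of 0
        "\<lambda>s. infdist (f s, g s) ?L" "\<lambda>s. \<bar>?h s\<bar>"]
    by (simp add: infdist_nonneg)
qed

section \<open>Profile curves, their first integrals and their symmetries\<close>

text \<open>
  The sign of \<open>a\<close> is left free so that the class of profiles is closed under reversal of orientation.
\<close>

locale soliton_profile =
  fixes a v :: real and y z \<theta> :: "real \<Rightarrow> real"
  assumes v_pos: "v > 0"
    and y_deriv: "\<And>s. (y has_real_derivative cos (\<theta> s)) (at s)"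
    and z_deriv: "\<And>s. (z has_real_derivative sin (\<theta> s)) (at s)"
    and angle_deriv: "\<And>s. (\<theta> has_real_derivative a + v * cos (\<theta> s)) (at s)"
begin

abbreviation curv :: "real \<Rightarrow> real" where
  "curv s \<equiv> a + v * cos (\<theta> s)"

lemma angle_integral: "\<theta> s - a * s - v * y s = \<theta> t - a * t - v * y t"
proof -
  have "((\<lambda>s. \<theta> s - a * s - v * y s) has_real_derivative 0) (at s)" for s
    by (auto intro!: derivative_eq_intros y_deriv angle_deriv)
  then show ?thesis
    by (intro DERIV_isconst_all[of "\<lambda>s. \<theta> s - a * s - v * y s"] allI)
qed

lemma curvature_integral: "curv s * exp (v * z s) = curv t * exp (v * z t)"
proof -
  have "((\<lambda>s. curv s * exp (v * z s)) has_real_derivative 0) (at s)" for s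
    by (auto intro!: derivative_eq_intros z_deriv angle_deriv simp: algebra_simps)
  then show ?thesis
    by (intro DERIV_isconst_all[of "\<lambda>s. curv s * exp (v * z s)"] allI)
qed

lemma curv_pos_iff: "curv s > 0 \<longleftrightarrow> curv t > 0"
proof -
  have "curv r > 0 \<longleftrightarrow> curv r * exp (v * z r) > 0" for r
    by (simp add: zero_less_mult_iff)
  then show ?thesis using curvature_integral[of s t] by simp
qed

lemma curv_zero_iff: "curv s = 0 \<longleftrightarrow> curv t = 0"
proof -
  have "curv r = 0 \<longleftrightarrow> curv r * exp (v * z r) = 0" for r by simp
  from this[of s] this[of t] show ?thesis using curvature_integral[of s t] by metis
qed

lemma height_determined:
  assumes "curv s = curv t" "curv s \<noteq> 0"
  shows "z s = z t"
  using curvature_integral[of s t] assms v_pos by simp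

lemma collinear_if_curv_zero:
  assumes "curv 0 = 0"
  shows "collinear (range (\<lambda>s. (y s, z s)))"
proof -
  have "(\<theta> has_real_derivative 0) (at s)" for s
    using angle_deriv[of s] curv_zero_iff[of s 0] assms by simp
  then have const: "\<theta> s = \<theta> 0" for s
    by (intro DERIV_isconst_all) auto
  have "((\<lambda>s. y s - s * cos (\<theta> 0)) has_real_derivative 0) (at s)" for s
    using const[of s] by (auto intro!: derivative_eq_intros y_deriv)
  then have ys: "y s - s * cos (\<theta> 0) = y 0 - 0 * cos (\<theta> 0)" for s
    by (intro DERIV_isconst_all[of "\<lambda>s. y s - s * cos (\<theta> 0)"] allI)
  have "((\<lambda>s. z s - s * sin (\<theta> 0)) has_real_derivative 0) (at s)" for s
    using const[of s] by (auto intro!: derivative_eq_intros z_deriv)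
  then have zs: "z s - s * sin (\<theta> 0) = z 0 - 0 * sin (\<theta> 0)" for s
    by (intro DERIV_isconst_all[of "\<lambda>s. z s - s * sin (\<theta> 0)"] allI)
  show ?thesis
    unfolding collinear_def
  proof (rule exI[of _ "(cos (\<theta> 0), sin (\<theta> 0))"], intro ballI)
    fix p q assume "p \<in> range (\<lambda>s. (y s, z s))" "q \<in> range (\<lambda>s. (y s, z s))"
    then obtain s t where "p = (y s, z s)" "q = (y t, z t)" by auto
    then show "\<exists>c. p - q = c *\<^sub>R (cos (\<theta> 0), sin (\<theta> 0))"
      using ys[of s] ys[of t] zs[of s] zs[of t]
      by (intro exI[of _ "s - t"]) (simp add: algebra_simps)
  qed
qed

text \<open>
  The system has three symmetries, which reduce the later case distinctions: reflection in a vertical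
  line, traversed backwards so that \<open>a\<close> is kept; reversal of orientation, which changes the signs of
  \<open>a\<close> and of the curvature; and the choice of the angle modulo \<open>2\<pi>\<close>.
\<close>

lemma reflected: "soliton_profile a v (\<lambda>s. - y (- s)) (\<lambda>s. z (- s)) (\<lambda>s. - \<theta> (- s))"
proof
  show "((\<lambda>s. - y (- s)) has_real_derivative cos (- \<theta> (- s))) (at s)" for s
    by (auto intro!: derivative_eq_intros DERIV_chain2[OF y_deriv, THEN DERIV_cong])
  show "((\<lambda>s. z (- s)) has_real_derivative sin (- \<theta> (- s))) (at s)" for s
    by (auto intro!: derivative_eq_intros DERIV_chain2[OF z_deriv, THEN DERIV_cong])
  show "((\<lambda>s. - \<theta> (- s)) has_real_derivative a + v * cos (- \<theta> (- s))) (at s)" for s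
    by (auto intro!: derivative_eq_intros DERIV_chain2[OF angle_deriv, THEN DERIV_cong])
qed (rule v_pos)

lemma reversed: "soliton_profile (- a) v (\<lambda>s. y (- s)) (\<lambda>s. z (- s)) (\<lambda>s. \<theta> (- s) - pi)"
proof
  show "((\<lambda>s. y (- s)) has_real_derivative cos (\<theta> (- s) - pi)) (at s)" for s
    by (auto intro!: derivative_eq_intros DERIV_chain2[OF y_deriv, THEN DERIV_cong])
  show "((\<lambda>s. z (- s)) has_real_derivative sin (\<theta> (- s) - pi)) (at s)" for s
    by (auto intro!: derivative_eq_intros DERIV_chain2[OF z_deriv, THEN DERIV_cong])
  show "((\<lambda>s. \<theta> (- s) - pi) has_real_derivative - a + v * cos (\<theta> (- s) - pi)) (at s)" for s
    by (auto intro!: derivative_eq_intros DERIV_chain2[OF angle_deriv, THEN DERIV_cong])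
qed (rule v_pos)

lemma rotated: "soliton_profile a v y z (\<lambda>s. \<theta> s + 2 * pi * of_int k)"
proof -
  have [simp]: "cos (\<theta> s + 2 * pi * of_int k) = cos (\<theta> s)" "sin (\<theta> s + 2 * pi * of_int k) = sin (\<theta> s)" for s
    using sin_cos_eq_iff[of "\<theta> s + 2 * pi * of_int k" "\<theta> s"] by auto
  show ?thesis
    by unfold_locales (auto intro!: v_pos y_deriv z_deriv derivative_eq_intros angle_deriv)
qed

lemma angle_unique:
  assumes "\<And>s. (\<phi> has_real_derivative a + v * cos (\<phi> s)) (at s)" and "\<phi> t = \<theta> t"
  shows "\<phi> s = \<theta> s"
proof (rule autonomous_ode_unique[where f = "\<lambda>p. a + v * cos p" and L = v and x = \<phi> and w = \<theta> and t = t])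
  fix p q :: real
  have "\<bar>cos p - cos q\<bar> = 2 * (\<bar>sin ((p + q) / 2)\<bar> * \<bar>sin ((q - p) / 2)\<bar>)"
    by (simp add: cos_diff_cos abs_mult)
  also have "\<dots> \<le> 2 * (1 * \<bar>(q - p) / 2\<bar>)"
    by (intro mult_left_mono mult_mono abs_sin_x_le_abs_x) auto
  finally have "\<bar>cos p - cos q\<bar> \<le> \<bar>p - q\<bar>" by simp
  then have "v * \<bar>cos p - cos q\<bar> \<le> v * \<bar>p - q\<bar>"
    using v_pos by (intro mult_left_mono) auto
  moreover have "\<bar>a + v * cos p - (a + v * cos q)\<bar> = v * \<bar>cos p - cos q\<bar>"
    using v_pos by (simp add: abs_mult flip: right_diff_distrib)
  ultimately show "\<bar>a + v * cos p - (a + v * cos q)\<bar> \<le> v * \<bar>p - q\<bar>" by simp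
qed (use assms angle_deriv in auto)

text \<open>
  Reflection in the vertical line through a point with horizontal tangent turns the profile into
  another one with the same angle at that point, hence, by uniqueness, into itself.
\<close>

lemma symmetric_at_horizontal_point:
  assumes "\<theta> m = 0"
  shows "\<theta> (2 * m - s) = - \<theta> s" and "y (2 * m - s) = 2 * y m - y s" and "z (2 * m - s) = z s"
proof -
  have "- \<theta> (2 * m - s) = \<theta> s" for s
  proof (rule angle_unique[of "\<lambda>s. - \<theta> (2 * m - s)" m])
    show "((\<lambda>s. - \<theta> (2 * m - s)) has_real_derivative a + v * cos (- \<theta> (2 * m - s))) (at s)" for s
      by (auto intro!: derivative_eq_intros DERIV_chain2[OF angle_deriv, THEN DERIV_cong])
  qed (simp add: assms)
  then have refl: "\<theta> (2 * m - s) = - \<theta> s" for s by (metis minus_minus)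
  show "\<theta> (2 * m - s) = - \<theta> s" by (rule refl)
  have "((\<lambda>s. y (2 * m - s) + y s) has_real_derivative 0) (at s)" for s
    by (auto intro!: derivative_eq_intros DERIV_chain2[OF y_deriv, THEN DERIV_cong] y_deriv simp: refl)
  then have "y (2 * m - s) + y s = y (2 * m - m) + y m"
    by (intro DERIV_isconst_all[of "\<lambda>s. y (2 * m - s) + y s"] allI)
  then show "y (2 * m - s) = 2 * y m - y s" by simp
  have "((\<lambda>s. z (2 * m - s) - z s) has_real_derivative 0) (at s)" for s
    by (auto intro!: derivative_eq_intros DERIV_chain2[OF z_deriv, THEN DERIV_cong] z_deriv simp: refl)
  then have "z (2 * m - s) - z s = z (2 * m - m) - z m"
    by (intro DERIV_isconst_all[of "\<lambda>s. z (2 * m - s) - z s"] allI)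
  then show "z (2 * m - s) = z s" by simp
qed

lemma trace_symmetric:
  assumes "\<theta> m = 0"
  shows "symmetric_about_vertical_line (range (\<lambda>s. (y s, z s)))"
proof -
  have "(\<lambda>(p, q). (2 * y m - p, q)) ` range (\<lambda>s. (y s, z s)) = range ((\<lambda>s. (y s, z s)) \<circ> (\<lambda>s. 2 * m - s))"
    by (simp add: image_image o_def symmetric_at_horizontal_point[OF assms])
  also have "\<dots> = (\<lambda>s. (y s, z s)) ` range (\<lambda>s. 2 * m - s)" by (rule image_comp[symmetric])
  also have "range (\<lambda>s. 2 * m - s) = UNIV" by (rule surjI[of _ "\<lambda>s. 2 * m - s"]) simp
  finally show ?thesis unfolding symmetric_about_vertical_line_def by blast
qed

lemma angle_strict_mono:
  assumes "curv 0 > 0"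
  shows "strict_mono \<theta>"
proof (rule strict_monoI)
  fix s t :: real assume "s < t"
  show "\<theta> s < \<theta> t"
  proof (rule DERIV_pos_imp_increasing[OF \<open>s < t\<close>])
    fix r
    have "curv r > 0" using curv_pos_iff[of r 0] assms by simp
    with angle_deriv show "\<exists>d. (\<theta> has_real_derivative d) (at r) \<and> d > 0" by blast
  qed
qed


section \<open>Curves whose angle keeps turning\<close>

lemma full_turn_periodic:
  assumes "\<theta> t = \<theta> r + 2 * pi"
  shows "\<theta> (s + (t - r)) = \<theta> s + 2 * pi"
proof -
  have "\<theta> (s + (t - r)) - 2 * pi = \<theta> s"
  proof (rule angle_unique[of "\<lambda>s. \<theta> (s + (t - r)) - 2 * pi" r])
    show "((\<lambda>s. \<theta> (s + (t - r)) - 2 * pi) has_real_derivative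
        a + v * cos (\<theta> (s + (t - r)) - 2 * pi)) (at s)" for s
      by (auto intro!: derivative_eq_intros DERIV_chain2[OF angle_deriv, THEN DERIV_cong] simp: cos_diff)
  qed (simp add: assms)
  then show ?thesis by simp
qed

text \<open>
  The function \<open>a y - sin \<theta>\<close> has derivative \<open>a cos \<theta> - cos \<theta> (a + v cos \<theta>) = - v (cos \<theta>)\<^sup>2\<close>. It decreases
  over a full turn, strictly so while \<open>\<theta>\<close> goes from \<open>0\<close> to \<open>\<pi>/2\<close>, whereas \<open>sin \<theta>\<close> has the same value at
  both ends.
\<close>

lemma full_turn_moves_left:
  assumes "a > 0" "strict_mono \<theta>" "\<theta> r = 0" "\<theta> t = 2 * pi"
    and onto: "surj \<theta>"
  shows "y t < y r"
proof -
  define G where "G s = a * y s - sin (\<theta> s)" for s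
  have G: "(G has_real_derivative - v * (cos (\<theta> s))\<^sup>2) (at s)" for s
    unfolding G_def
    by (auto intro!: derivative_eq_intros y_deriv angle_deriv simp: algebra_simps power2_eq_square)
  obtain q where q: "\<theta> q = pi / 2" using onto by (metis surjD)
  have "\<theta> r < \<theta> q" "\<theta> q < \<theta> t" unfolding q assms(3,4) by simp_all
  then have order: "r < q" "q < t" using strict_mono_less[OF assms(2)] by auto
  have "G q < G r"
  proof (rule DERIV_neg_imp_decreasing_open[OF \<open>r < q\<close>])
    fix s assume "r < s" "s < q"
    then have "0 < \<theta> s" "\<theta> s < pi / 2"
      using strict_mono_less[OF assms(2)] assms(3) q by (metis, metis)
    then have "cos (\<theta> s) > 0" by (intro cos_gt_zero) auto
    then have "- v * (cos (\<theta> s))\<^sup>2 < 0" using v_pos by simp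
    with G show "\<exists>d. (G has_real_derivative d) (at s) \<and> d < 0" by blast
  next
    show "continuous_on {r..q} G"
      by (rule continuous_on_if_differentiable[OF G])
  qed
  moreover have "G t \<le> G q"
  proof (rule DERIV_nonpos_imp_nonincreasing[OF less_imp_le[OF order(2)]])
    have "- v * (cos (\<theta> s))\<^sup>2 \<le> 0" for s using v_pos by simp
    with G show "\<exists>d. (G has_real_derivative d) (at s) \<and> d \<le> 0" for s by blast
  qed
  moreover have "G r = a * y r" "G t = a * y t" by (simp_all add: G_def assms(3,4))
  ultimately have "a * y t < a * y r" by linarith
  then show ?thesis using \<open>a > 0\<close> by (simp only: mult_less_cancel_left_pos)
qed

lemma angle_diverges:
  assumes "a > v"
  shows "filterlim \<theta> at_top at_top" and "filterlim \<theta> at_bot at_bot" and "surj \<theta>"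
proof -
  have "curv s \<ge> a - v" for s
    using mult_left_mono[OF cos_ge_minus_one[of "\<theta> s"], of v] v_pos by simp
  with angle_deriv assms show "filterlim \<theta> at_top at_top" "filterlim \<theta> at_bot at_bot" "surj \<theta>"
    using derivative_bounded_below_diverges[of \<theta> curv "a - v"] by auto
qed

text \<open>
  A full turn leaves the curvature unchanged, hence also \<open>z\<close> by the curvature integral; by the angle
  integral it changes \<open>y\<close> by an amount \<open>d\<close> independent of the starting point. The group is \<open>\<int> d\<close>.
\<close>

lemma trace_translation_invariant:
  assumes "a > v"
  shows "invariant_under_discrete_horizontal_translations (range (\<lambda>s. (y s, z s)))"
proof -
  let ?\<alpha> = "\<lambda>s. (y s, z s)"
  have "v * cos (\<theta> 0) \<ge> - v"
    using mult_left_mono[OF cos_ge_minus_one[of "\<theta> 0"], of v] v_pos by simp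
  then have curv0: "curv 0 > 0" using assms by simp
  obtain r t where rt: "\<theta> r = 0" "\<theta> t = 2 * pi"
    using angle_diverges(3)[OF assms] by (metis surjD)
  define T where "T = t - r"
  define d where "d = y t - y r"
  have "d < 0"
    using full_turn_moves_left[of r t] rt angle_diverges(3)[OF assms] angle_strict_mono[OF curv0] assms v_pos
    by (simp add: d_def)
  have turn: "\<theta> (s + T) = \<theta> s + 2 * pi" for s
    unfolding T_def using rt by (intro full_turn_periodic) simp
  have "v * (y (s + T) - y s) = 2 * pi - a * T" for s
    using angle_integral[of "s + T" s] turn[of s] by (simp add: algebra_simps)
  from this[of r] this have yT: "y (s + T) = y s + d" for s
    using v_pos unfolding d_def T_def
    by (metis add.commute diff_add_cancel diff_eq_eq less_irrefl mult_cancel_left)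
  have zT: "z (s + T) = z s" for s
    using curv_pos_iff[of "s + T" 0] curv0 turn[of s] by (intro height_determined) auto
  have shift: "\<forall>s. ?\<alpha> (s + of_int n * T) = ?\<alpha> s + (of_int n * d, 0)" for n :: int
  proof (induction n rule: int_induct[where k = 0])
    case base
    show ?case by (simp add: zero_prod_def)
  next
    case (step1 n)
    show ?case
    proof
      fix s
      have "?\<alpha> (s + of_int (n + 1) * T) = ?\<alpha> (s + of_int n * T) + (d, 0)"
        using yT[of "s + of_int n * T"] zT[of "s + of_int n * T"] by (simp add: algebra_simps)
      then show "?\<alpha> (s + of_int (n + 1) * T) = ?\<alpha> s + (of_int (n + 1) * d, 0)"
        using step1(2) by (simp add: algebra_simps)
    qed
  next
    case (step2 n)
    show ?case
    proof
      fix s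
      have "?\<alpha> (s + of_int n * T) = ?\<alpha> (s + of_int (n - 1) * T) + (d, 0)"
        using yT[of "s + of_int (n - 1) * T"] zT[of "s + of_int (n - 1) * T"] by (simp add: algebra_simps)
      then show "?\<alpha> (s + of_int (n - 1) * T) = ?\<alpha> s + (of_int (n - 1) * d, 0)"
        using step2(2) by (simp add: algebra_simps)
    qed
  qed
  define G where "G = range (\<lambda>n::int. (of_int n * d, 0::real))"
  have "additive_subgroup G"
    unfolding additive_subgroup_def
  proof (intro conjI ballI)
    show "0 \<in> G" unfolding G_def by (rule range_eqI[of _ _ 0]) (simp add: zero_prod_def)
  next
    fix p q assume "p \<in> G" "q \<in> G"
    then obtain i j :: int where "p = (of_int i * d, 0)" "q = (of_int j * d, 0)" by (auto simp: G_def)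
    then show "p + q \<in> G" unfolding G_def by (intro range_eqI[of _ _ "i + j"]) (simp add: algebra_simps)
  next
    fix p assume "p \<in> G"
    then obtain i :: int where "p = (of_int i * d, 0)" by (auto simp: G_def)
    then show "- p \<in> G" unfolding G_def by (intro range_eqI[of _ _ "- i"]) simp
  qed
  moreover have "discrete G"
    unfolding discrete_def isolated_in_dist_Ex_iff
  proof (intro ballI conjI exI[of _ "\<bar>d\<bar>"] impI)
    show "0 < \<bar>d\<bar>" using \<open>d < 0\<close> by simp
  next
    fix p q assume "p \<in> G" "q \<in> G" "dist p q < \<bar>d\<bar>"
    moreover from this obtain i j :: int where "p = (of_int i * d, 0)" "q = (of_int j * d, 0)"
      by (auto simp: G_def)
    moreover have "\<bar>of_int i * d - of_int j * d\<bar> = \<bar>of_int (i - j)\<bar> * \<bar>d\<bar>"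
      by (simp add: algebra_simps flip: abs_mult)
    ultimately have "of_int \<bar>i - j\<bar> * \<bar>d\<bar> < 1 * \<bar>d\<bar>"
      by (simp add: dist_Pair_Pair dist_real_def)
    then have "real_of_int \<bar>i - j\<bar> < 1" using \<open>d < 0\<close> by (simp add: mult_less_cancel_right)
    then have "\<bar>i - j\<bar> < 1" by linarith
    then show "q = p" using \<open>p = _\<close> \<open>q = _\<close> by simp
  qed
  moreover have "(d, 0) \<in> G" unfolding G_def by (rule range_eqI[of _ _ 1]) simp
  then have "G \<noteq> {0}" using \<open>d < 0\<close> by (auto simp: zero_prod_def)
  moreover have "\<forall>g\<in>G. snd g = 0" by (auto simp: G_def)
  moreover have "(\<lambda>p. p + g) ` range ?\<alpha> = range ?\<alpha>" if "g \<in> G" for g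
  proof -
    obtain n :: int where n: "g = (of_int n * d, 0)" using \<open>g \<in> G\<close> by (auto simp: G_def)
    have "(\<lambda>p. p + g) ` range ?\<alpha> = range (?\<alpha> \<circ> (\<lambda>s. s + of_int n * T))"
      using shift[of n] by (simp add: image_image o_def n)
    also have "\<dots> = ?\<alpha> ` range (\<lambda>s. s + of_int n * T)" by (rule image_comp[symmetric])
    also have "range (\<lambda>s. s + of_int n * T) = UNIV"
      by (rule surjI[of _ "\<lambda>s. s - of_int n * T"]) simp
    finally show ?thesis .
  qed
  ultimately show ?thesis
    unfolding invariant_under_discrete_horizontal_translations_def by blast
qed

end

section \<open>Curves whose angle is trapped between two equilibria\<close>

text \<open>
  The zeros of \<open>a + v cos\<close> nearest to \<open>0\<close> are \<open>\<plusminus> arccos (-a/v)\<close>, and the curvature is positive between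
  them. The strict inequality at \<open>s = 0\<close> rules out \<open>a = -v\<close>, for which there is no room between the
  two.
\<close>

locale trapped_profile = soliton_profile +
  assumes a_bounds: "- v \<le> a" "a \<le> v"
    and trapped_start: "\<bar>\<theta> 0\<bar> < arccos (- (a / v))"
begin

abbreviation \<tau> :: real where "\<tau> \<equiv> arccos (- (a / v))"

lemma cos_limit_angle: "cos \<tau> = - (a / v)"
  using a_bounds v_pos by (intro cos_arccos) (auto simp: field_simps)

lemma limit_angle_bounds: "0 < \<tau>" "\<tau> \<le> pi"
proof -
  show "0 < \<tau>" using trapped_start by linarith
  show "\<tau> \<le> pi" using a_bounds v_pos by (intro arccos_ubound) (auto simp: field_simps)
qed

lemma curv_pos_if_trapped:
  assumes "\<bar>p\<bar> < \<tau>"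
  shows "a + v * cos p > 0"
proof -
  have "cos \<tau> < cos \<bar>p\<bar>"
    using assms limit_angle_bounds by (intro cos_monotone_0_pi) auto
  then have "- (a / v) < cos p" by (simp add: cos_limit_angle)
  then show ?thesis using v_pos by (simp add: field_simps)
qed

lemma curv_pos: "curv s > 0"
  using curv_pos_iff[of s 0] curv_pos_if_trapped[OF trapped_start] by simp

lemma angle_mono: "strict_mono \<theta>"
  by (rule angle_strict_mono[OF curv_pos])

lemma reflected_trapped: "trapped_profile a v (\<lambda>s. - y (- s)) (\<lambda>s. z (- s)) (\<lambda>s. - \<theta> (- s))"
  using reflected a_bounds trapped_start
  by (simp add: trapped_profile_def trapped_profile_axioms_def)

lemma continuous_angle: "continuous_on S \<theta>"
  by (rule continuous_on_if_differentiable[OF angle_deriv])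

text \<open>
  The angle cannot cross the equilibrium \<open>\<tau>\<close>, because the curvature would vanish there.
\<close>

lemma angle_less: "\<theta> s < \<tau>"
proof (rule ccontr)
  assume "\<not> \<theta> s < \<tau>"
  then have above: "\<theta> s \<ge> \<tau>" by simp
  then have "\<theta> 0 < \<theta> s" using trapped_start by linarith
  then have "0 < s" using strict_mono_less[OF angle_mono] by simp
  then obtain r where "\<theta> r = \<tau>"
    using IVT'[of \<theta> 0 \<tau> s] above trapped_start continuous_angle by force
  then show False using curv_pos[of r] cos_limit_angle v_pos by simp
qed

lemma angle_greater: "- \<tau> < \<theta> s"
proof -
  interpret R: trapped_profile a v "\<lambda>s. - y (- s)" "\<lambda>s. z (- s)" "\<lambda>s. - \<theta> (- s)"
    by (rule reflected_trapped)
  show ?thesis using R.angle_less[of "- s"] by simp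
qed

lemma angle_tendsto_top: "(\<theta> \<longlongrightarrow> \<tau>) at_top"
proof (rule autonomous_ode_tendsto_barrier[where f = "\<lambda>p. a + v * cos p"])
  show "a + v * cos p > 0" if "\<theta> 0 \<le> p" "p < \<tau>" for p
    using that angle_greater[of 0] by (intro curv_pos_if_trapped) auto
qed (auto intro!: angle_deriv curv_pos angle_less continuous_intros)

lemma angle_tendsto_bot: "(\<theta> \<longlongrightarrow> - \<tau>) at_bot"
proof -
  interpret R: trapped_profile a v "\<lambda>s. - y (- s)" "\<lambda>s. z (- s)" "\<lambda>s. - \<theta> (- s)"
    by (rule reflected_trapped)
  have "((\<lambda>s. - (- \<theta> (- s))) \<longlongrightarrow> - \<tau>) at_top"
    by (intro tendsto_minus R.angle_tendsto_top)
  then show ?thesis by (simp add: filterlim_at_bot_mirror)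
qed

lemma range_angle: "range \<theta> = {- \<tau><..<\<tau>}"
proof
  show "range \<theta> \<subseteq> {- \<tau><..<\<tau>}" using angle_less angle_greater by auto
  show "{- \<tau><..<\<tau>} \<subseteq> range \<theta>"
  proof
    fix p assume p: "p \<in> {- \<tau><..<\<tau>}"
    have "\<forall>\<^sub>F s in at_top. p < \<theta> s" "\<forall>\<^sub>F s in at_bot. \<theta> s < p"
      using order_tendstoD[OF angle_tendsto_top] order_tendstoD[OF angle_tendsto_bot] p by auto
    then obtain s t where st: "\<theta> s < p" "p < \<theta> t"
      unfolding eventually_at_top_linorder eventually_at_bot_linorder by blast
    then have "s < t" using strict_mono_less[OF angle_mono] by (meson less_trans)
    then show "p \<in> range \<theta>"
      using IVT'[of \<theta> s p t] st continuous_angle by force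
  qed
qed

lemma angle_attains:
  assumes "\<bar>p\<bar> < \<tau>"
  obtains s where "\<theta> s = p"
  using range_angle assms by (metis abs_less_iff greaterThanLessThan_iff imageE minus_less_iff)

lemma limit_angle_obtuse: "pi / 2 < \<tau>" if "a > 0"
proof (rule ccontr)
  assume "\<not> pi / 2 < \<tau>"
  then have "cos \<tau> \<ge> 0" using limit_angle_bounds by (intro cos_ge_zero) auto
  then show False using that v_pos by (simp add: cos_limit_angle field_simps)
qed

text \<open>
  Let \<open>m\<close> be the parameter of the point with horizontal tangent. Since \<open>z\<close> is symmetric about \<open>m\<close> and
  strictly increasing to the right of it, two parameters with equal height are mirror images of each
  other, and the two points agree only if they lie on the axis of symmetry. To the right of \<open>m\<close> the
  function \<open>y\<close> increases until \<open>\<theta> = \<pi>/2\<close> and decreases afterwards. It returns to the value \<open>y m\<close>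
  because \<open>v (y s - y m) = \<theta> s - a (s - m)\<close> with \<open>\<theta>\<close> bounded and \<open>a > 0\<close>.
\<close>

lemma unique_self_intersection:
  assumes "a > 0"
  shows "card (self_intersection_points (\<lambda>s. (y s, z s))) = 1"
proof -
  obtain m where m: "\<theta> m = 0" using angle_attains[of 0] limit_angle_bounds by auto
  obtain q where q: "\<theta> q = pi / 2"
    using angle_attains[of "pi / 2"] limit_angle_obtuse[OF assms] by (auto simp: abs_if)
  have "m < q" using strict_mono_less[OF angle_mono, of m q] m q by simp
  note less = strict_mono_less[OF angle_mono]
  have cont: "continuous_on S y" "continuous_on S z" for S
    by (rule continuous_on_if_differentiable[OF y_deriv] continuous_on_if_differentiable[OF z_deriv])+
  have z_incr: "z s < z t" if "m \<le> s" "s < t" for s t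
  proof (rule DERIV_pos_imp_increasing_open[OF \<open>s < t\<close> _ cont(2)])
    fix r assume "s < r" "r < t"
    then have "0 < \<theta> r" using less[of m r] m that by simp
    then have "sin (\<theta> r) > 0"
      using angle_less[of r] limit_angle_bounds by (intro sin_gt_zero) auto
    with z_deriv show "\<exists>d. (z has_real_derivative d) (at r) \<and> d > 0" by blast
  qed
  have y_incr: "y m < y t" if "m < t" "t \<le> q" for t
  proof (rule DERIV_pos_imp_increasing_open[OF \<open>m < t\<close> _ cont(1)])
    fix r assume "m < r" "r < t"
    then have "0 < \<theta> r" "\<theta> r < pi / 2" using less[of m r] less[of r q] m q that by auto
    then have "cos (\<theta> r) > 0" by (intro cos_gt_zero) auto
    with y_deriv show "\<exists>d. (y has_real_derivative d) (at r) \<and> d > 0" by blast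
  qed
  have y_decr: "y t < y s" if "q \<le> s" "s < t" for s t
  proof (rule DERIV_neg_imp_decreasing_open[OF \<open>s < t\<close> _ cont(1)])
    fix r assume "s < r" "r < t"
    then have "pi / 2 < \<theta> r" using less[of q r] q that by simp
    then have "cos (\<theta> r) < cos (pi / 2)"
      using angle_less[of r] limit_angle_bounds by (intro cos_monotone_0_pi) auto
    then have "cos (\<theta> r) < 0" by simp
    with y_deriv show "\<exists>d. (y has_real_derivative d) (at r) \<and> d < 0" by blast
  qed
  obtain c where c: "m < c" "y c = y m"
  proof -
    \<comment> \<open>By the angle integral, \<open>y t \<le> y m\<close> as soon as \<open>a (t - m)\<close> exceeds the angle bound \<open>\<tau>\<close>.\<close>
    define t where "t = max q (m + \<tau> / a)"
    have "\<tau> / a \<le> t - m" by (simp add: t_def)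
    then have "\<tau> \<le> a * (t - m)" using assms by (simp add: field_simps)
    then have "v * y t \<le> v * y m"
      using angle_integral[of t m] angle_less[of t] m by (simp add: algebra_simps)
    then have "y t \<le> y m" using v_pos by simp
    then obtain c where "q \<le> c" "y c = y m"
      using IVT2'[of y t "y m" q] y_incr[of q] \<open>m < q\<close> cont(1) by (auto simp: t_def)
    then show ?thesis using that[of c] \<open>m < q\<close> by simp
  qed
  have c_unique: "s = c" if s: "m < s" "y s = y m" for s
  proof -
    have "q < s" "q < c" using y_incr[of s] y_incr[of c] s c by force+
    then show ?thesis using y_decr[of s c] y_decr[of c s] s c by (cases s c rule: linorder_cases) auto
  qed
  have mirror: "y (2 * m - s) = 2 * y m - y s" "z (2 * m - s) = z s" for s
    using symmetric_at_horizontal_point[OF m] by auto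
  have "self_intersection_points (\<lambda>s. (y s, z s)) = {(y c, z c)}"
  proof
    show "{(y c, z c)} \<subseteq> self_intersection_points (\<lambda>s. (y s, z s))"
      unfolding self_intersection_points_def
      using mirror[of c] c by (simp, intro exI[of _ c] exI[of _ "2 * m - c"]) simp
    show "self_intersection_points (\<lambda>s. (y s, z s)) \<subseteq> {(y c, z c)}"
    proof
      fix p assume "p \<in> self_intersection_points (\<lambda>s. (y s, z s))"
      then obtain s t where st: "s \<noteq> t" "p = (y s, z s)" "y s = y t" "z s = z t"
        unfolding self_intersection_points_def by auto
      \<comment> \<open>Fold the parameter line at \<open>m\<close>, so that mirror images are identified.\<close>
      define fold where "fold r = m + \<bar>r - m\<bar>" for r
      have fold: "fold r = r \<or> fold r = 2 * m - r" "m \<le> fold r" for r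
        by (auto simp: fold_def abs_if)
      have "z (fold r) = z r" for r using fold(1)[of r] mirror(2)[of r] by auto
      then have "z (fold s) = z (fold t)" using st by simp
      then have "fold s = fold t"
        using z_incr[of "fold s" "fold t"] z_incr[of "fold t" "fold s"] fold(2)
        by (cases "fold s" "fold t" rule: linorder_cases) auto
      then have t: "t = 2 * m - s" using st(1) by (auto simp: fold_def abs_if split: if_splits)
      then have ys: "y s = y m" using mirror(1)[of s] st(3) by simp
      have "s \<noteq> m" using t st(1) by auto
      then have "fold s > m" by (simp add: fold_def)
      moreover have "y (fold s) = y m" using fold(1)[of s] ys mirror(1)[of s] by auto
      ultimately have "fold s = c" by (rule c_unique)
      then show "p \<in> {(y c, z c)}" using fold(1)[of s] st t by auto
    qed
  qed
  then show ?thesis by simp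
qed

lemma trapped_trace_symmetric:
  "symmetric_about_vertical_line (range (\<lambda>s. (y s, z s)))"
proof -
  obtain m where "\<theta> m = 0" using angle_attains[of 0] limit_angle_bounds by auto
  then show ?thesis by (rule trace_symmetric)
qed

text \<open>
  Here \<open>y' = cos \<theta>\<close> is bounded below by \<open>-a/v > 0\<close>, so \<open>y\<close> is a bijection of the real line, and the
  curve is the graph of \<open>z \<circ> y\<^sup>-\<^sup>1\<close>. The derivative of this function is the slope \<open>tan \<theta>\<close>, which increases
  with \<open>\<theta> \<in> (-\<pi>/2, \<pi>/2)\<close>.
\<close>

lemma convex_graph:
  assumes "a < 0"
  shows "convex_entire_graph (range (\<lambda>s. (y s, z s)))"
proof -
  have acute: "\<tau> < pi / 2"
  proof (rule ccontr)
    assume "\<not> \<tau> < pi / 2"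
    then have "cos \<tau> \<le> cos (pi / 2)"
      using limit_angle_bounds by (intro cos_monotone_0_pi_le) auto
    then show False using assms v_pos by (simp add: cos_limit_angle field_simps)
  qed
  have cos_bound: "cos (\<theta> s) \<ge> - (a / v)" for s
    using curv_pos[of s] v_pos by (simp add: field_simps)
  have slope_pos: "- (a / v) > 0" using assms v_pos by (simp add: field_simps)
  have cos_pos: "cos (\<theta> s) > 0" for s using cos_bound[of s] slope_pos by linarith
  have onto: "surj y"
    by (rule derivative_bounded_below_diverges(3)[OF y_deriv cos_bound slope_pos])
  have incr: "strict_mono y"
  proof (rule strict_monoI)
    fix s t :: real assume "s < t"
    then show "y s < y t"
      using y_deriv cos_pos by (intro DERIV_pos_imp_increasing[OF \<open>s < t\<close>]) meson
  qed
  define g where "g = inv y"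
  have gy: "g (y s) = s" for s
    unfolding g_def using strict_mono_imp_inj_on[OF incr] by simp
  have yg: "y (g p) = p" for p unfolding g_def using onto by (rule surj_f_inv_f)
  have g_cont: "isCont g p" for p
    using isCont_inverse_function[of 1 "g p" g y] gy yg DERIV_isCont[OF y_deriv] by simp
  have g_deriv: "(g has_real_derivative inverse (cos (\<theta> (g p)))) (at p)" for p
    using cos_pos[of "g p"] yg g_cont
    by (intro DERIV_inverse_function[where f = y and a = "p - 1" and b = "p + 1"] y_deriv) auto
  define f where "f p = z (g p)" for p
  have f_deriv: "(f has_real_derivative tan (\<theta> (g p))) (at p)" for p
    unfolding f_def by (rule DERIV_chain2[OF z_deriv g_deriv, THEN DERIV_cong])
      (simp add: tan_def field_simps)
  have "convex_on UNIV f"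
  proof (rule convex_on_realI[OF _ f_deriv])
    fix p q :: real assume "p \<le> q"
    have "g p \<le> g q"
      using strict_mono_less_eq[OF incr, of "g p" "g q"] \<open>p \<le> q\<close> by (simp add: yg)
    then have "\<theta> (g p) \<le> \<theta> (g q)" using strict_mono_less_eq[OF angle_mono] by simp
    then show "tan (\<theta> (g p)) \<le> tan (\<theta> (g q))"
      using angle_greater[of "g p"] angle_less[of "g q"] acute by (intro tan_mono_le) auto
  qed simp
  moreover have "range (\<lambda>s. (y s, z s)) = {(p, q). q = f p}"
  proof (auto simp: f_def gy)
    fix p
    show "(p, z (g p)) \<in> range (\<lambda>s. (y s, z s))"
      by (rule range_eqI[of _ _ "g p"]) (simp add: yg)
  qed
  ultimately show ?thesis unfolding convex_entire_graph_def by blast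
qed

text \<open>
  The grim reaper is the curve \<open>\<phi> \<mapsto> (\<phi>/v, - log \<bar>cos \<phi>\<bar> / v)\<close> with \<open>\<bar>\<phi>\<bar> < \<pi>/2\<close>. For \<open>a = 0\<close> the first
  integrals say that the profile is this curve at \<open>\<phi> = \<theta>\<close>, up to a translation.
\<close>

lemma trace_grim_reaper:
  assumes "a = 0"
  shows "\<exists>p. range (\<lambda>s. (y s, z s)) = (\<lambda>q. q + p) ` grim_reaper v"
proof -
  define c where "c \<phi> = (\<phi> / v, - (1 / v) * ln \<bar>cos \<phi>\<bar>)" for \<phi> :: real
  have tau: "\<tau> = pi / 2" by (simp add: assms arccos_0)
  have "grim_reaper v = c ` {- (pi / 2)<..<pi / 2}"
  proof
    show "c ` {- (pi / 2)<..<pi / 2} \<subseteq> grim_reaper v"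
      using v_pos by (auto simp: c_def grim_reaper_def field_simps abs_less_iff)
    show "grim_reaper v \<subseteq> c ` {- (pi / 2)<..<pi / 2}"
    proof
      fix p assume "p \<in> grim_reaper v"
      then have p: "\<bar>fst p\<bar> < pi / (2 * v)" "snd p = - (1 / v) * ln \<bar>cos (v * fst p)\<bar>"
        by (auto simp: grim_reaper_def)
      have "p = c (v * fst p)" using p(2) v_pos by (simp add: c_def prod_eq_iff)
      moreover have "v * fst p \<in> {- (pi / 2)<..<pi / 2}"
        using p(1) v_pos by (auto simp: abs_less_iff field_simps)
      ultimately show "p \<in> c ` {- (pi / 2)<..<pi / 2}" by blast
    qed
  qed
  also have "\<dots> = range (\<lambda>s. c (\<theta> s))"
    using range_angle by (simp add: tau image_image flip: image_image[of c \<theta>])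
  finally have reaper: "grim_reaper v = range (\<lambda>s. c (\<theta> s))" .
  define p where "p = (y 0 - \<theta> 0 / v, z 0 + ln (cos (\<theta> 0)) / v)"
  have "(y s, z s) = c (\<theta> s) + p" for s
  proof -
    have "v * y s = \<theta> s - \<theta> 0 + v * y 0"
      using angle_integral[of s 0] assms by simp
    then have "y s = \<theta> s / v + (y 0 - \<theta> 0 / v)" using v_pos by (simp add: field_simps)
    moreover have cos_pos: "cos (\<theta> r) > 0" for r
      using curv_pos[of r] v_pos assms by (simp add: zero_less_mult_iff)
    have "ln (cos (\<theta> s) * exp (v * z s)) = ln (cos (\<theta> 0) * exp (v * z 0))"
      using curvature_integral[of s 0] v_pos assms by simp
    then have "ln (cos (\<theta> s)) + v * z s = ln (cos (\<theta> 0)) + v * z 0"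
      using cos_pos[of s] cos_pos[of 0] by (simp add: ln_mult)
    then have "z s = - (1 / v) * ln \<bar>cos (\<theta> s)\<bar> + (z 0 + ln (cos (\<theta> 0)) / v)"
      using v_pos cos_pos[of s] by (simp add: divide_simps) (simp add: algebra_simps)
    ultimately show ?thesis by (simp add: c_def p_def)
  qed
  then have "range (\<lambda>s. (y s, z s)) = (\<lambda>q. q + p) ` grim_reaper v"
    by (simp add: reaper image_image)
  then show ?thesis by blast
qed


text \<open>
  Since \<open>cos \<tau> = -a/v\<close>, the angle integral says that \<open>y - s cos \<tau>\<close> is \<open>\<theta>/v\<close> up to a constant. The vertical
  counterpart is that \<open>z - s sin \<tau>\<close> is \<open>- (2/v) log (sin ((\<theta> + \<tau>)/2))\<close> up to a constant. To see this,
  factor the curvature as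
  \<open>v (cos \<theta> - cos \<tau>) = 2 v sin ((\<theta> + \<tau>)/2) sin ((\<tau> - \<theta>)/2)\<close>: the derivative of
  \<open>(2/v) log (sin ((\<theta> + \<tau>)/2))\<close> becomes
  \<open>2 cos ((\<theta> + \<tau>)/2) sin ((\<tau> - \<theta>)/2) = sin \<tau> - sin \<theta>\<close>. Both expressions are continuous at \<open>\<theta> = \<tau>\<close>,
  because \<open>0 < \<tau> < \<pi>\<close>, so no rate of convergence of \<open>\<theta>\<close> is needed.
\<close>

lemma asymptotic_direction:
  assumes "- v < a" "a < v"
  shows "\<exists>p. ((\<lambda>s. y s - s * cos \<tau>) \<longlongrightarrow> p) at_top"
    and "\<exists>q. ((\<lambda>s. z s - s * sin \<tau>) \<longlongrightarrow> q) at_top"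
proof -
  have "\<tau> < pi"
    using cos_limit_angle limit_angle_bounds(2) assms v_pos by (cases "\<tau> = pi") (auto simp: field_simps)
  then have sin_pos: "sin \<tau> > 0" using limit_angle_bounds by (intro sin_gt_zero) auto
  have "y s - s * cos \<tau> = \<theta> s / v + (y 0 - \<theta> 0 / v)" for s
  proof -
    have "v * y s = \<theta> s - a * s + (v * y 0 - \<theta> 0)"
      using angle_integral[of s 0] by simp
    then show ?thesis unfolding cos_limit_angle using v_pos by (simp add: field_simps)
  qed
  moreover have "((\<lambda>s. \<theta> s / v + (y 0 - \<theta> 0 / v)) \<longlongrightarrow> \<tau> / v + (y 0 - \<theta> 0 / v)) at_top"
    using v_pos by (intro tendsto_intros angle_tendsto_top) auto
  ultimately show "\<exists>p. ((\<lambda>s. y s - s * cos \<tau>) \<longlongrightarrow> p) at_top" by auto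
  \<comment> \<open>The correction that makes \<open>z - s sin \<tau> + D\<close> a first integral.\<close>
  define D where "D s = 2 / v * ln (sin ((\<theta> s + \<tau>) / 2))" for s
  have half_pos: "sin ((\<theta> s + \<tau>) / 2) > 0" for s
    using angle_less[of s] angle_greater[of s] \<open>\<tau> < pi\<close> by (intro sin_gt_zero) auto
  have D_deriv: "(D has_real_derivative sin \<tau> - sin (\<theta> s)) (at s)" for s
  proof -
    let ?h = "(\<theta> s + \<tau>) / 2"
    have "(D has_real_derivative 2 / v * (cos ?h * (curv s / 2) / sin ?h)) (at s)"
      unfolding D_def using half_pos[of s] v_pos
      by (auto intro!: derivative_eq_intros angle_deriv simp: field_simps)
    moreover have "curv s = v * (2 * sin ?h * sin ((\<tau> - \<theta> s) / 2))"
      using cos_limit_angle v_pos cos_diff_cos[of "\<theta> s" \<tau>] by (simp add: field_simps)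
    then have "2 / v * (cos ?h * (curv s / 2) / sin ?h) = 2 * (cos ?h * sin ((\<tau> - \<theta> s) / 2))"
      using v_pos half_pos[of s] by (simp add: field_simps)
    moreover have "\<dots> = sin \<tau> - sin (\<theta> s)"
      using sin_diff_sin[of \<tau> "\<theta> s"] by (simp add: add.commute mult.commute)
    ultimately show ?thesis by simp
  qed
  have "((\<lambda>s. z s - s * sin \<tau> + D s) has_real_derivative 0) (at s)" for s
    by (auto intro!: derivative_eq_intros z_deriv D_deriv)
  then have "z s - s * sin \<tau> + D s = z 0 - 0 * sin \<tau> + D 0" for s
    by (intro DERIV_isconst_all[of "\<lambda>s. z s - s * sin \<tau> + D s"] allI)
  then have "z s - s * sin \<tau> = z 0 + D 0 - D s" for s by (simp add: eq_diff_eq)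
  moreover have "((\<lambda>s. z 0 + D 0 - D s) \<longlongrightarrow> z 0 + D 0 - 2 / v * ln (sin ((\<tau> + \<tau>) / 2))) at_top"
    unfolding D_def using sin_pos v_pos by (intro tendsto_intros angle_tendsto_top) auto
  ultimately show "\<exists>q. ((\<lambda>s. z s - s * sin \<tau>) \<longlongrightarrow> q) at_top" by auto
qed

lemma branches_asymptotic:
  assumes "- v < a" "a < v" "a \<noteq> 0"
  shows "\<exists>c. branch_asymptotic_to (\<lambda>s. (y s, z s)) at_top (line_with_slope (tan \<tau>) c)"
    and "\<exists>c. branch_asymptotic_to (\<lambda>s. (y s, z s)) at_bot (line_with_slope (- tan \<tau>) c)"
proof -
  have cos_nz: "cos \<tau> \<noteq> 0" using assms v_pos by (simp add: cos_limit_angle)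
  obtain p q where pq: "((\<lambda>s. y s - s * cos \<tau>) \<longlongrightarrow> p) at_top" "((\<lambda>s. z s - s * sin \<tau>) \<longlongrightarrow> q) at_top"
    using asymptotic_direction assms by blast
  have "branch_asymptotic_to (\<lambda>s. (y s, z s)) at_top
      (line_with_slope (sin \<tau> / cos \<tau>) (q - sin \<tau> / cos \<tau> * p))"
    by (intro branch_asymptotic_toI pq cos_nz filterlim_at_top_imp_at_infinity filterlim_ident)
  then show "\<exists>c. branch_asymptotic_to (\<lambda>s. (y s, z s)) at_top (line_with_slope (tan \<tau>) c)"
    by (auto simp: tan_def)
  \<comment> \<open>The end at \<open>-\<infinity>\<close> is the end at \<open>+\<infinity>\<close> of the mirror image.\<close>
  interpret R: trapped_profile a v "\<lambda>s. - y (- s)" "\<lambda>s. z (- s)" "\<lambda>s. - \<theta> (- s)"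
    by (rule reflected_trapped)
  obtain p q where pq: "((\<lambda>s. - y (- s) - s * cos \<tau>) \<longlongrightarrow> p) at_top"
    "((\<lambda>s. z (- s) - s * sin \<tau>) \<longlongrightarrow> q) at_top"
    using R.asymptotic_direction assms by blast
  have "((\<lambda>s. - (- y (- s) - s * cos \<tau>)) \<longlongrightarrow> - p) at_top"
    by (intro tendsto_minus pq)
  then have "((\<lambda>s. y s - s * cos \<tau>) \<longlongrightarrow> - p) at_bot"
    by (simp add: filterlim_at_bot_mirror add.commute)
  moreover have "((\<lambda>s. z s - s * (- sin \<tau>)) \<longlongrightarrow> q) at_bot"
    using pq(2) by (simp add: filterlim_at_bot_mirror)
  ultimately have "branch_asymptotic_to (\<lambda>s. (y s, z s)) at_bot
      (line_with_slope (- sin \<tau> / cos \<tau>) (q - (- sin \<tau> / cos \<tau>) * (- p)))"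
    by (intro branch_asymptotic_toI cos_nz filterlim_at_bot_imp_at_infinity filterlim_ident)
  then show "\<exists>c. branch_asymptotic_to (\<lambda>s. (y s, z s)) at_bot (line_with_slope (- tan \<tau>) c)"
    by (auto simp: tan_def)
qed

end

section \<open>The classification\<close>

context soliton_profile
begin

text \<open>
  Positive curvature means \<open>cos (\<theta> 0) > - a/v\<close>, so the representative of \<open>\<theta> 0\<close> in \<open>(-\<pi>, \<pi>]\<close> lies
  between the two equilibria nearest to \<open>0\<close>.
\<close>

lemma trapped_after_rotation:
  assumes "- v \<le> a" "a \<le> v" "curv 0 > 0"
  obtains k :: int where "trapped_profile a v y z (\<lambda>s. \<theta> s + 2 * pi * of_int k)"
proof -
  obtain p where p: "- pi < p" "p \<le> pi" "sin p = sin (\<theta> 0)" "cos p = cos (\<theta> 0)"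
    using sincos_principal_value by blast
  then obtain k :: int where k: "p = \<theta> 0 + 2 * pi * of_int k"
    using sin_cos_eq_iff by blast
  have bounds: "- 1 \<le> - (a / v)" "- (a / v) \<le> 1" using assms v_pos by (auto simp: field_simps)
  have "\<bar>p\<bar> < arccos (- (a / v))"
  proof (rule ccontr)
    assume "\<not> \<bar>p\<bar> < arccos (- (a / v))"
    then have "cos \<bar>p\<bar> \<le> cos (arccos (- (a / v)))"
      using p arccos_lbound[OF bounds] by (intro cos_monotone_0_pi_le) auto
    then have "cos (\<theta> 0) \<le> - (a / v)" using bounds p(4) by (simp add: cos_arccos)
    then show False using assms v_pos by (simp add: field_simps)
  qed
  then have "trapped_profile a v y z (\<lambda>s. \<theta> s + 2 * pi * of_int k)"
    using rotated[of k] assms by (simp add: trapped_profile_def trapped_profile_axioms_def k)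
  then show ?thesis by (rule that)
qed

end

lemma abs_tan_eq_if_abs_cos_eq:
  fixes p q :: real
  assumes "\<bar>cos p\<bar> = \<bar>cos q\<bar>"
  shows "\<bar>tan p\<bar> = \<bar>tan q\<bar>"
proof -
  have "(cos p)\<^sup>2 = (cos q)\<^sup>2" using assms by (simp add: abs_eq_iff power2_eq_iff)
  then have "(sin p)\<^sup>2 = (sin q)\<^sup>2" by (simp add: sin_squared_eq)
  then have "\<bar>sin p\<bar> = \<bar>sin q\<bar>" by (metis abs_eq_iff power2_eq_iff)
  then show ?thesis using assms by (simp add: tan_def abs_divide)
qed

theorem theorem2p4:
  fixes v\<^sub>1 v\<^sub>3 lam \<theta>\<^sub>0 :: real
    and y z \<theta> :: "real \<Rightarrow> real"
    and \<alpha> :: "real \<Rightarrow> real \<times> real"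
  assumes "norm (vector [v\<^sub>1, 0, v\<^sub>3] :: real^3) = 1"
    and "v\<^sub>3 > 0"
    and "lam \<ge> 0"
    and "\<And>s. (y has_real_derivative cos (\<theta> s)) (at s)"
    and "\<And>s. (z has_real_derivative sin (\<theta> s)) (at s)"
    and "\<And>s. (\<theta> has_real_derivative 2 * lam + v\<^sub>3 * cos (\<theta> s)) (at s)"
    and "y 0 = 0" and "z 0 = 0" and "\<theta> 0 = \<theta>\<^sub>0"
    and "\<And>s. \<alpha> s = (y s, z s)"
    and "\<not> collinear (range \<alpha>)"
  shows
    "(lam > v\<^sub>3 / 2 \<longrightarrow>
        invariant_under_discrete_horizontal_translations (range \<alpha>) \<and>
        filterlim \<theta> at_top at_top \<and> filterlim \<theta> at_bot at_bot) \<and>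
     (lam = v\<^sub>3 / 2 \<longrightarrow>
        card (self_intersection_points \<alpha>) = 1 \<and>
        symmetric_about_vertical_line (range \<alpha>)) \<and>
     (0 < lam \<and> lam < v\<^sub>3 / 2 \<longrightarrow>
        (\<exists>\<theta>\<^sub>1. 2 * lam + v\<^sub>3 * cos \<theta>\<^sub>1 = 0) \<and>
        (\<forall>\<theta>\<^sub>1. 2 * lam + v\<^sub>3 * cos \<theta>\<^sub>1 = 0 \<longrightarrow>
           (\<exists>m \<in> {tan \<theta>\<^sub>1, - tan \<theta>\<^sub>1}. \<exists>c d.
              branch_asymptotic_to \<alpha> at_top (line_with_slope m c) \<and>
              branch_asymptotic_to \<alpha> at_bot (line_with_slope (- m) d))) \<and>
        (if 2 * lam + v\<^sub>3 * cos \<theta>\<^sub>0 > 0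
         then symmetric_about_vertical_line (range \<alpha>) \<and>
              card (self_intersection_points \<alpha>) = 1
         else convex_entire_graph (range \<alpha>))) \<and>
     (lam = 0 \<longrightarrow> (\<exists>p. range \<alpha> = (\<lambda>q. q + p) ` grim_reaper v\<^sub>3))"
proof -
  let ?\<alpha> = "\<lambda>s. (y s, z s)"
  have \<alpha>: "\<alpha> = ?\<alpha>" using assms(10) by auto
  interpret P: soliton_profile "2 * lam" v\<^sub>3 y z \<theta>
    using assms(2,4-6) by unfold_locales
  interpret R: soliton_profile "- (2 * lam)" v\<^sub>3 "\<lambda>s. y (- s)" "\<lambda>s. z (- s)" "\<lambda>s. \<theta> (- s) - pi"
    by (rule P.reversed)
  have curved: "P.curv 0 \<noteq> 0"
  proof
    assume "P.curv 0 = 0"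
    then have "collinear (range ?\<alpha>)" by (rule P.collinear_if_curv_zero)
    with assms(11) show False unfolding \<alpha> by (rule notE)
  qed
  have same_trace: "range (\<lambda>s. (y (- s), z (- s))) = range ?\<alpha>"
  proof -
    have "range (?\<alpha> \<circ> uminus) = ?\<alpha> ` range uminus" by (rule image_comp[symmetric])
    then show ?thesis by (simp add: o_def surj_uminus)
  qed
  have positive: thesis
    if "P.curv 0 > 0" "2 * lam \<le> v\<^sub>3"
      and "\<And>k. trapped_profile (2 * lam) v\<^sub>3 y z (\<lambda>s. \<theta> s + 2 * pi * of_int k) \<Longrightarrow> thesis"
    for thesis
  proof (rule P.trapped_after_rotation)
    show "- v\<^sub>3 \<le> 2 * lam" "2 * lam \<le> v\<^sub>3" "P.curv 0 > 0" using that(1,2) assms(2,3) by simp_all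
  qed (rule that(3))
  \<comment> \<open>If the curvature is negative, the reversed curve has positive curvature for the parameter \<open>-a\<close>.\<close>
  have negative: thesis
    if "P.curv 0 < 0" "2 * lam \<le> v\<^sub>3"
      and "\<And>k. trapped_profile (- (2 * lam)) v\<^sub>3 (\<lambda>s. y (- s)) (\<lambda>s. z (- s))
        (\<lambda>s. \<theta> (- s) - pi + 2 * pi * of_int k) \<Longrightarrow> thesis"
    for thesis
  proof (rule R.trapped_after_rotation)
    show "- v\<^sub>3 \<le> - (2 * lam)" "- (2 * lam) \<le> v\<^sub>3" "R.curv 0 > 0"
      using that(1,2) assms(2,3) by simp_all
  qed (rule that(3))
  have loop: "symmetric_about_vertical_line (range \<alpha>) \<and> card (self_intersection_points \<alpha>) = 1"
    if "P.curv 0 > 0" "0 < lam" "2 * lam \<le> v\<^sub>3"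
  proof (rule positive[OF that(1,3)])
    fix k assume "trapped_profile (2 * lam) v\<^sub>3 y z (\<lambda>s. \<theta> s + 2 * pi * of_int k)"
    then interpret T: trapped_profile "2 * lam" v\<^sub>3 y z "\<lambda>s. \<theta> s + 2 * pi * of_int k" .
    show ?thesis unfolding \<alpha>
      using T.trapped_trace_symmetric T.unique_self_intersection that(2) by simp
  qed
  have case1: "invariant_under_discrete_horizontal_translations (range \<alpha>) \<and>
      filterlim \<theta> at_top at_top \<and> filterlim \<theta> at_bot at_bot" if "lam > v\<^sub>3 / 2"
    unfolding \<alpha> using P.trace_translation_invariant P.angle_diverges that by simp
  have case2: "card (self_intersection_points \<alpha>) = 1 \<and> symmetric_about_vertical_line (range \<alpha>)"
    if "lam = v\<^sub>3 / 2"
  proof -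
    have "P.curv 0 = v\<^sub>3 * (1 + cos (\<theta> 0))" using that by (simp add: algebra_simps)
    moreover have "1 + cos (\<theta> 0) \<ge> 0" using cos_ge_minus_one[of "\<theta> 0"] by linarith
    ultimately have "P.curv 0 > 0" using curved assms(2) by (metis less_le mult_nonneg_nonneg less_imp_le)
    then show ?thesis using loop that assms(2) by simp
  qed
  have case3: "(\<exists>\<theta>\<^sub>1. 2 * lam + v\<^sub>3 * cos \<theta>\<^sub>1 = 0) \<and>
        (\<forall>\<theta>\<^sub>1. 2 * lam + v\<^sub>3 * cos \<theta>\<^sub>1 = 0 \<longrightarrow>
           (\<exists>m \<in> {tan \<theta>\<^sub>1, - tan \<theta>\<^sub>1}. \<exists>c d.
              branch_asymptotic_to \<alpha> at_top (line_with_slope m c) \<and>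
              branch_asymptotic_to \<alpha> at_bot (line_with_slope (- m) d))) \<and>
        (if 2 * lam + v\<^sub>3 * cos \<theta>\<^sub>0 > 0
         then symmetric_about_vertical_line (range \<alpha>) \<and>
              card (self_intersection_points \<alpha>) = 1
         else convex_entire_graph (range \<alpha>))"
    if lam: "0 < lam" "lam < v\<^sub>3 / 2"
  proof (intro conjI allI impI)
    define \<omega> where "\<omega> = arccos (- (2 * lam / v\<^sub>3))"
    have cos_\<omega>: "cos \<omega> = - (2 * lam / v\<^sub>3)"
      unfolding \<omega>_def using lam assms(2) by (intro cos_arccos) (auto simp: field_simps)
    then show "\<exists>\<theta>\<^sub>1. 2 * lam + v\<^sub>3 * cos \<theta>\<^sub>1 = 0"
      using assms(2) by (intro exI[of _ \<omega>]) simp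
    have "\<exists>w c d. \<bar>cos w\<bar> = 2 * lam / v\<^sub>3 \<and>
        branch_asymptotic_to \<alpha> at_top (line_with_slope (tan w) c) \<and>
        branch_asymptotic_to \<alpha> at_bot (line_with_slope (- tan w) d)"
    proof (cases "P.curv 0 > 0")
      case True
      show ?thesis
      proof (rule positive[OF True])
        show "2 * lam \<le> v\<^sub>3" using lam by simp
        fix k assume "trapped_profile (2 * lam) v\<^sub>3 y z (\<lambda>s. \<theta> s + 2 * pi * of_int k)"
        then interpret T: trapped_profile "2 * lam" v\<^sub>3 y z "\<lambda>s. \<theta> s + 2 * pi * of_int k" .
        obtain c d where
          "branch_asymptotic_to \<alpha> at_top (line_with_slope (tan T.\<tau>) c)"
          "branch_asymptotic_to \<alpha> at_bot (line_with_slope (- tan T.\<tau>) d)"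
          unfolding \<alpha> using T.branches_asymptotic lam assms(2) by auto
        moreover have "\<bar>cos T.\<tau>\<bar> = 2 * lam / v\<^sub>3"
          using T.cos_limit_angle lam assms(2) by simp
        ultimately show ?thesis by blast
      qed
    next
      case False
      then have "P.curv 0 < 0" using curved by linarith
      then show ?thesis
      proof (rule negative)
        show "2 * lam \<le> v\<^sub>3" using lam by simp
        fix k assume "trapped_profile (- (2 * lam)) v\<^sub>3 (\<lambda>s. y (- s)) (\<lambda>s. z (- s))
          (\<lambda>s. \<theta> (- s) - pi + 2 * pi * of_int k)"
        then interpret T: trapped_profile "- (2 * lam)" v\<^sub>3 "\<lambda>s. y (- s)" "\<lambda>s. z (- s)"
          "\<lambda>s. \<theta> (- s) - pi + 2 * pi * of_int k" .
        obtain c d where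
          c: "branch_asymptotic_to (\<lambda>s. (y (- s), z (- s))) at_top (line_with_slope (tan T.\<tau>) c)" and
          d: "branch_asymptotic_to (\<lambda>s. (y (- s), z (- s))) at_bot (line_with_slope (- tan T.\<tau>) d)"
          using T.branches_asymptotic lam assms(2) by auto
        have "branch_asymptotic_to \<alpha> at_bot (line_with_slope (tan T.\<tau>) c)"
          using c unfolding \<alpha> branch_asymptotic_to_def filterlim_at_top_mirror by simp
        moreover have "branch_asymptotic_to \<alpha> at_top (line_with_slope (- tan T.\<tau>) d)"
          using d unfolding \<alpha> branch_asymptotic_to_def filterlim_at_bot_mirror by simp
        moreover have "\<bar>cos (- T.\<tau>)\<bar> = 2 * lam / v\<^sub>3"
          using T.cos_limit_angle lam assms(2) by simp
        \<comment> \<open>Reversal exchanges the two ends, hence the signs of the slopes.\<close>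
        ultimately show ?thesis by (intro exI[of _ "- T.\<tau>"] exI[of _ d] exI[of _ c]) simp
      qed
    qed
    then obtain w c d where w: "\<bar>cos w\<bar> = 2 * lam / v\<^sub>3"
      "branch_asymptotic_to \<alpha> at_top (line_with_slope (tan w) c)"
      "branch_asymptotic_to \<alpha> at_bot (line_with_slope (- tan w) d)" by blast
    fix \<theta>\<^sub>1 assume "2 * lam + v\<^sub>3 * cos \<theta>\<^sub>1 = 0"
    then have "cos \<theta>\<^sub>1 = - (2 * lam / v\<^sub>3)" using assms(2) by (simp add: field_simps)
    then have "\<bar>cos w\<bar> = \<bar>cos \<theta>\<^sub>1\<bar>" using w(1) lam assms(2) by simp
    then have "tan w \<in> {tan \<theta>\<^sub>1, - tan \<theta>\<^sub>1}"
      using abs_tan_eq_if_abs_cos_eq[of w \<theta>\<^sub>1] by (auto simp: abs_eq_iff)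
    with w show "\<exists>m \<in> {tan \<theta>\<^sub>1, - tan \<theta>\<^sub>1}. \<exists>c d.
        branch_asymptotic_to \<alpha> at_top (line_with_slope m c) \<and>
        branch_asymptotic_to \<alpha> at_bot (line_with_slope (- m) d)" by blast
  next
    have "convex_entire_graph (range \<alpha>)" if "P.curv 0 < 0"
    proof (rule negative[OF that])
      show "2 * lam \<le> v\<^sub>3" using lam by simp
      fix k assume "trapped_profile (- (2 * lam)) v\<^sub>3 (\<lambda>s. y (- s)) (\<lambda>s. z (- s))
        (\<lambda>s. \<theta> (- s) - pi + 2 * pi * of_int k)"
      then interpret T: trapped_profile "- (2 * lam)" v\<^sub>3 "\<lambda>s. y (- s)" "\<lambda>s. z (- s)"
        "\<lambda>s. \<theta> (- s) - pi + 2 * pi * of_int k" .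
      show "convex_entire_graph (range \<alpha>)"
        unfolding \<alpha> using T.convex_graph lam same_trace by simp
    qed
    then show "if 2 * lam + v\<^sub>3 * cos \<theta>\<^sub>0 > 0
         then symmetric_about_vertical_line (range \<alpha>) \<and> card (self_intersection_points \<alpha>) = 1
         else convex_entire_graph (range \<alpha>)"
      using loop lam curved assms(9) by auto
  qed
  have case4: "\<exists>p. range \<alpha> = (\<lambda>q. q + p) ` grim_reaper v\<^sub>3" if "lam = 0"
  proof (cases "P.curv 0 > 0")
    case True
    show ?thesis
    proof (rule positive[OF True])
      show "2 * lam \<le> v\<^sub>3" using that assms(2) by simp
      fix k assume "trapped_profile (2 * lam) v\<^sub>3 y z (\<lambda>s. \<theta> s + 2 * pi * of_int k)"
      then interpret T: trapped_profile "2 * lam" v\<^sub>3 y z "\<lambda>s. \<theta> s + 2 * pi * of_int k" .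
      show ?thesis unfolding \<alpha> using T.trace_grim_reaper that by simp
    qed
  next
    case False
    then have "P.curv 0 < 0" using curved by linarith
    then show ?thesis
    proof (rule negative)
      show "2 * lam \<le> v\<^sub>3" using that assms(2) by simp
      fix k assume "trapped_profile (- (2 * lam)) v\<^sub>3 (\<lambda>s. y (- s)) (\<lambda>s. z (- s))
        (\<lambda>s. \<theta> (- s) - pi + 2 * pi * of_int k)"
      then interpret T: trapped_profile "- (2 * lam)" v\<^sub>3 "\<lambda>s. y (- s)" "\<lambda>s. z (- s)"
        "\<lambda>s. \<theta> (- s) - pi + 2 * pi * of_int k" .
      show ?thesis unfolding \<alpha> using T.trace_grim_reaper that same_trace by simp
    qed
  qed
  show ?thesis using case1 case2 case3 case4 by blast
qed

end
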